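(* Let $k\ge1$ and $n\ge4$ be integers. The rank over $\mathbb{Z}_2$ of any $(n,k)$-matrix is at least $(n-3)^2/2^k$.
   Context: $[n]=\{1,\dots,n\}$. A $k$-octahedron is a tuple $P=P_1*\dots*P_{k+1}$ of 2-element subsets $P_i\subset[n]$, identified with the set of $k$-faces $\{(1,a_1),\dots,(k+1,a_{k+1})\}$, $a_i\in P_i$, of the complex $[n]^{*k+1}$ (vertex set $[k+1]\times[n]$, $k$-faces spanned by one vertex from each $\{i\}\times[n]$). $P,Q$ are vertex-disjoint if $P_i\cap Q_i=\emptyset$ for all $i$; $\oplus$ is symmetric difference of sets of $k$-faces. An $(n,k)$-matrix is a $\mathbb{Z}_2$-matrix $A$ indexed (rows and columns) by all $k$-octahedra such that: $A$ is symmetric; $A_{P,Q}=0$ whenever $P,Q$ are vertex-disjoint; $A_{P,Q}=A_{X,Q}+A_{Y,Q}$ whenever $P=X\oplus Y$ for $k$-octahedra $X,Y$; and $\sum A_{P,Q}=1$, the sum over all unordered pairs $\{P,Q\}$ of $k$-octahedra with $P_i,Q_i\subset[3]$ and $P_i\cap Q_i=\{1\}$ for all $i\in[k+1]$. *)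

theory Defs
  imports Complex_Main "HOL-Library.FuncSet" "HOL-Library.Function_Algebras" "HOL-Library.Z2"
begin

definition fun_scale :: "'b::field \<Rightarrow> ('a \<Rightarrow> 'b) \<Rightarrow> 'a \<Rightarrow> 'b" where
  "fun_scale c f = (\<lambda>x. c * f x)"

global_interpretation fun_vs: vector_space "fun_scale :: 'b::field \<Rightarrow> ('a \<Rightarrow> 'b) \<Rightarrow> 'a \<Rightarrow> 'b"
  by standard (auto simp: fun_scale_def fun_eq_iff algebra_simps)

text \<open>
  A matrix over a field with rows indexed by \<open>I\<close> and columns indexed by \<open>J\<close> is a function of two
  arguments whose values outside \<open>I \<times> J\<close> are irrelevant; columns are therefore cut off to zero
  outside \<open>I\<close> before taking the dimension of the column space.
\<close>

definition mat_column :: "'i set \<Rightarrow> ('i \<Rightarrow> 'j \<Rightarrow> 'b::field) \<Rightarrow> 'j \<Rightarrow> 'i \<Rightarrow> 'b" where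
  "mat_column I A j = (\<lambda>i. if i \<in> I then A i j else 0)"

definition mat_rank :: "'i set \<Rightarrow> 'j set \<Rightarrow> ('i \<Rightarrow> 'j \<Rightarrow> 'b::field) \<Rightarrow> nat" where
  "mat_rank I J A = fun_vs.dim (mat_column I A ` J)"

text \<open>A \<open>k\<close>-octahedron is the tuple of its \<open>k + 1\<close> two-element sets, as an extensional function.\<close>

type_synonym octahedron = "nat \<Rightarrow> nat set"

definition octahedra :: "nat \<Rightarrow> nat \<Rightarrow> octahedron set" where
  "octahedra n k = ({1..k+1} \<rightarrow>\<^sub>E {S. S \<subseteq> {1..n} \<and> card S = 2})"

definition faces :: "nat \<Rightarrow> octahedron \<Rightarrow> (nat \<times> nat) set set" where
  "faces k P = {{(i, a i) | i. i \<in> {1..k+1}} | a. \<forall>i\<in>{1..k+1}. a i \<in> P i}"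

definition vertex_disjoint :: "nat \<Rightarrow> octahedron \<Rightarrow> octahedron \<Rightarrow> bool" where
  "vertex_disjoint k P Q \<longleftrightarrow> (\<forall>i\<in>{1..k+1}. P i \<inter> Q i = {})"

text \<open>
  The entry of a symmetric matrix at an unordered pair of indices; the description is
  well defined exactly because of the symmetry.
\<close>

definition pair_entry :: "('i \<Rightarrow> 'i \<Rightarrow> 'b) \<Rightarrow> 'i set \<Rightarrow> 'b" where
  "pair_entry A e = (THE v. \<exists>P Q. e = {P, Q} \<and> v = A P Q)"

lemma pair_entry_eq: "pair_entry A {P, Q} = A P Q" if "A P Q = A Q P"
  unfolding pair_entry_def using that by (intro the_equality) (auto simp: doubleton_eq_iff)

definition special_pairs :: "nat \<Rightarrow> nat \<Rightarrow> octahedron set set" where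
  "special_pairs n k = {{P, Q} | P Q. P \<in> octahedra n k \<and> Q \<in> octahedra n k \<and>
     (\<forall>i\<in>{1..k+1}. P i \<subseteq> {1..3} \<and> Q i \<subseteq> {1..3} \<and> P i \<inter> Q i = {1})}"

definition nk_matrix :: "nat \<Rightarrow> nat \<Rightarrow> (octahedron \<Rightarrow> octahedron \<Rightarrow> bit) \<Rightarrow> bool" where
  "nk_matrix n k A \<longleftrightarrow>
     (\<forall>P\<in>octahedra n k. \<forall>Q\<in>octahedra n k. A P Q = A Q P) \<and>
     (\<forall>P\<in>octahedra n k. \<forall>Q\<in>octahedra n k. vertex_disjoint k P Q \<longrightarrow> A P Q = 0) \<and>
     (\<forall>P\<in>octahedra n k. \<forall>X\<in>octahedra n k. \<forall>Y\<in>octahedra n k. \<forall>Q\<in>octahedra n k.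
        faces k P = sym_diff (faces k X) (faces k Y) \<longrightarrow> A P Q = A X Q + A Y Q) \<and>
     (\<Sum>e\<in>special_pairs n k. pair_entry A e) = 1"

end

theory Submission
  imports Defs "HOL-Combinatorics.Transposition" "HOL-Library.Ramsey"
begin

text \<open>
  Octahedra are pure tensors of edges, and an \<open>(n,k)\<close>-matrix is a symmetric form that is a cocycle
  in each tensor factor. If \<open>P\<close> and \<open>Q\<close> are disjoint outside one coordinate, the entry depends only
  on the vertex shared in that coordinate, and not on the order of the two edges meeting there.
  Therefore summing over the two placements of \<open>{1,2}\<close>, \<open>{1,3}\<close> in one coordinate turns an
  \<open>(n,k+1)\<close>-matrix into an \<open>(n,k)\<close>-matrix of at most twice the rank, which reduces to \<open>k = 1\<close>.

  For \<open>k = 1\<close> take rows \<open>{2,b} * {1,x}\<close> and columns \<open>{1,c} * {1,y}\<close> with \<open>b, c \<noteq> 1, 2\<close> and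
  \<open>x, y \<noteq> 1\<close>, grouped into blocks by \<open>b\<close> and \<open>c\<close>. Diagonal blocks are tournament matrices
  \<open>V\<close>, that is, \<open>V x y + V y x = 1\<close> for \<open>x \<noteq> y\<close>; off-diagonal blocks are constant off their
  diagonals, hence diagonal after a correction of the part above the block diagonal, which has
  rank at most \<open>n - 3\<close>. A tournament matrix of size \<open>m\<close> has rank at least \<open>(m - 1)/2\<close>, and
  elimination shows that diagonal blocks above the block diagonal do not spoil the sum of these
  bounds. So the rank is at least \<open>(n-2)^2/2 - (n-3) > (n-3)^2/2\<close>.
\<close>

declare add_bit_eq_xor [simp del] mult_bit_eq_and [simp del]

section \<open>Rank over a field\<close>

definition independent_columns :: "'i set \<Rightarrow> 'j set \<Rightarrow> ('i \<Rightarrow> 'j \<Rightarrow> 'b::field) \<Rightarrow> bool" where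
  "independent_columns I Y M \<longleftrightarrow>
     (\<forall>\<alpha>. (\<forall>i\<in>I. (\<Sum>j\<in>Y. \<alpha> j * M i j) = 0) \<longrightarrow> (\<forall>j\<in>Y. \<alpha> j = 0))"

lemma independent_columnsI:
  assumes "\<And>\<alpha> j. (\<And>i. i \<in> I \<Longrightarrow> (\<Sum>j\<in>Y. \<alpha> j * M i j) = 0) \<Longrightarrow> j \<in> Y \<Longrightarrow> \<alpha> j = 0"
  shows "independent_columns I Y M"
  using assms unfolding independent_columns_def by blast

lemma independent_columnsD:
  assumes "independent_columns I Y M" "\<And>i. i \<in> I \<Longrightarrow> (\<Sum>j\<in>Y. \<alpha> j * M i j) = 0" "j \<in> Y"
  shows "\<alpha> j = 0"
  using assms unfolding independent_columns_def by blast

lemma sum_scale_mat_column_eq_0_iff: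
  "(\<Sum>j\<in>Y. fun_scale (\<alpha> j) (mat_column I M j)) = 0 \<longleftrightarrow> (\<forall>i\<in>I. (\<Sum>j\<in>Y. \<alpha> j * M i j) = 0)"
proof -
  have "(\<Sum>j\<in>Y. fun_scale (\<alpha> j) (mat_column I M j)) i = (if i \<in> I then \<Sum>j\<in>Y. \<alpha> j * M i j else 0)"
    for i
    by (induction Y rule: infinite_finite_induct) (auto simp: fun_scale_def mat_column_def)
  then show ?thesis
    by (auto simp: fun_eq_iff)
qed

lemma independent_columns_imp_inj_on:
  assumes "finite Y" "independent_columns I Y M"
  shows "inj_on (mat_column I M) Y"
proof (rule inj_onI, rule ccontr)
  fix p q assume pq: "p \<in> Y" "q \<in> Y" "mat_column I M p = mat_column I M q" "p \<noteq> q"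
  define \<alpha> :: "_ \<Rightarrow> 'c" where "\<alpha> j = of_bool (j = p) - of_bool (j = q)" for j
  have "(\<Sum>j\<in>Y. \<alpha> j * M i j) = 0" if "i \<in> I" for i
  proof -
    have "(\<Sum>j\<in>Y. \<alpha> j * M i j) =
        (\<Sum>j\<in>Y. if j = p then M i j else 0) - (\<Sum>j\<in>Y. if j = q then M i j else 0)"
      unfolding sum_subtractf[symmetric] by (rule sum.cong) (auto simp: \<alpha>_def)
    also have "\<dots> = M i p - M i q"
      using assms(1) pq(1,2) by simp
    also have "\<dots> = 0"
      using fun_cong[OF pq(3), of i] that by (simp add: mat_column_def)
    finally show ?thesis .
  qed
  then have "\<alpha> p = 0"
    by (rule independent_columnsD[OF assms(2) _ pq(1)])
  then show False
    using pq(4) by (simp add: \<alpha>_def)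
qed

lemma independent_columns_iff_independent_image:
  assumes "finite Y" and inj: "inj_on (mat_column I M) Y"
  shows "independent_columns I Y M \<longleftrightarrow> fun_vs.independent (mat_column I M ` Y)"
proof -
  have reindex: "(\<Sum>v\<in>mat_column I M ` Y. fun_scale (u v) v) =
      (\<Sum>j\<in>Y. fun_scale (u (mat_column I M j)) (mat_column I M j))" for u
    by (rule sum.reindex_cong[OF inj]) auto
  show ?thesis
  proof
    assume "independent_columns I Y M"
    then show "fun_vs.independent (mat_column I M ` Y)"
      using assms by (auto simp: fun_vs.dependent_finite reindex sum_scale_mat_column_eq_0_iff
          independent_columns_def)
  next
    assume ind: "fun_vs.independent (mat_column I M ` Y)"
    show "independent_columns I Y M"
    proof (rule independent_columnsI)
      fix \<alpha> j assume zero: "\<And>i. i \<in> I \<Longrightarrow> (\<Sum>j\<in>Y. \<alpha> j * M i j) = 0" and "j \<in> Y"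
      define u where "u v = \<alpha> (the_inv_into Y (mat_column I M) v)" for v
      have u_column: "u (mat_column I M l) = \<alpha> l" if "l \<in> Y" for l
        using the_inv_into_f_f[OF inj that] by (simp add: u_def)
      have "(\<Sum>v\<in>mat_column I M ` Y. fun_scale (u v) v) = 0"
        using zero by (simp add: reindex u_column sum_scale_mat_column_eq_0_iff cong: sum.cong)
      then have "u (mat_column I M j) = 0"
        using ind assms(1) \<open>j \<in> Y\<close> fun_vs.dependent_finite by blast
      then show "\<alpha> j = 0"
        using u_column \<open>j \<in> Y\<close> by simp
    qed
  qed
qed

lemma card_le_mat_rank:
  assumes "finite J" "Y \<subseteq> J" "independent_columns I Y M"
  shows "card Y \<le> mat_rank I J M"
proof -
  have fin: "finite Y"
    using assms finite_subset by blast
  have inj: "inj_on (mat_column I M) Y"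
    using independent_columns_imp_inj_on fin assms(3) by blast
  obtain B where B: "B \<subseteq> mat_column I M ` J" "mat_column I M ` J \<subseteq> fun_vs.span B"
      "card B = mat_rank I J M"
    using fun_vs.basis_exists[of "mat_column I M ` J"] unfolding mat_rank_def by metis
  have "card (mat_column I M ` Y) \<le> card B"
  proof (rule fun_vs.independent_span_bound[THEN conjunct2])
    show "finite B"
      using B(1) assms(1) finite_subset by blast
    show "fun_vs.independent (mat_column I M ` Y)"
      using independent_columns_iff_independent_image[OF fin inj] assms(3) by blast
    show "mat_column I M ` Y \<subseteq> fun_vs.span B"
      using B(2) assms(2) by blast
  qed
  then show ?thesis
    using B(3) card_image[OF inj] by simp
qed

lemma obtain_independent_columns:
  assumes "finite J"
  obtains Y where "Y \<subseteq> J" "finite Y" "card Y = mat_rank I J M" "independent_columns I Y M"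
proof -
  obtain B where B: "B \<subseteq> mat_column I M ` J" "fun_vs.independent B" "card B = mat_rank I J M"
    using fun_vs.basis_exists[of "mat_column I M ` J"] unfolding mat_rank_def by metis
  obtain Y where Y: "Y \<subseteq> J" "inj_on (mat_column I M) Y" "B = mat_column I M ` Y"
    using B(1) subset_image_inj by metis
  have "finite Y"
    using Y(1) assms finite_subset by blast
  with Y B that show ?thesis
    by (metis card_image independent_columns_iff_independent_image)
qed

lemma mat_rank_le_card:
  assumes "finite L" "\<And>i j. i \<in> I \<Longrightarrow> j \<in> J \<Longrightarrow> M i j = (\<Sum>l\<in>L. u l i * v l j)"
  shows "mat_rank I J M \<le> card L"
proof -
  let ?U = "\<lambda>l i. if i \<in> I then u l i else 0"
  have "mat_column I M j \<in> fun_vs.span (?U ` L)" if "j \<in> J" for j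
  proof -
    have "(\<Sum>l\<in>L. fun_scale (v l j) (?U l)) i = (if i \<in> I then \<Sum>l\<in>L. u l i * v l j else 0)" for i
      by (induction L rule: infinite_finite_induct) (auto simp: fun_scale_def mult.commute)
    then have "mat_column I M j = (\<Sum>l\<in>L. fun_scale (v l j) (?U l))"
      using assms(2) that by (simp add: fun_eq_iff mat_column_def)
    also have "\<dots> \<in> fun_vs.span (?U ` L)"
      by (rule fun_vs.span_sum, rule fun_vs.span_scale, rule fun_vs.span_base) simp
    finally show ?thesis .
  qed
  then have "mat_rank I J M \<le> card (?U ` L)"
    unfolding mat_rank_def by (intro fun_vs.dim_le_card) (use assms(1) in auto)
  also have "\<dots> \<le> card L"
    using assms(1) by (rule card_image_le)
  finally show ?thesis .
qed

lemma mat_rank_factorization: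
  assumes "finite J"
  obtains u v where "\<And>i j. i \<in> I \<Longrightarrow> j \<in> J \<Longrightarrow> M i j = (\<Sum>l<mat_rank I J M. u l i * v l j)"
proof -
  obtain B where B: "B \<subseteq> mat_column I M ` J" "fun_vs.independent B"
      "mat_column I M ` J \<subseteq> fun_vs.span B" "card B = mat_rank I J M"
    using fun_vs.basis_exists[of "mat_column I M ` J"] unfolding mat_rank_def by metis
  have fin: "finite B"
    using B(1) assms finite_subset by blast
  obtain h where h: "bij_betw h {..<mat_rank I J M} B"
    using B(4) ex_bij_betw_nat_finite[OF fin] by (metis atLeast0LessThan)
  define r where "r j = fun_vs.representation B (mat_column I M j)" for j
  have "M i j = (\<Sum>l<mat_rank I J M. h l i * r j (h l))" if "i \<in> I" "j \<in> J" for i j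
  proof -
    have "M i j = mat_column I M j i"
      using that(1) by (simp add: mat_column_def)
    also have "mat_column I M j = (\<Sum>b\<in>B. fun_scale (r j b) b)"
      unfolding r_def using fun_vs.sum_representation_eq[OF B(2) _ fin order.refl] B(3) that(2)
      by auto
    also have "\<dots> i = (\<Sum>b\<in>B. b i * r j b)"
      by (induction B rule: infinite_finite_induct) (auto simp: fun_scale_def)
    also have "\<dots> = (\<Sum>l<mat_rank I J M. h l i * r j (h l))"
      by (rule sum.reindex_bij_betw[OF h, symmetric])
    finally show ?thesis .
  qed
  then show ?thesis
    by (rule that)
qed

lemma mat_rank_reindex_le:
  assumes "finite J" "f ` I' \<subseteq> I" "g ` J' \<subseteq> J" "\<And>i j. i \<in> I' \<Longrightarrow> j \<in> J' \<Longrightarrow> M' i j = M (f i) (g j)"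
  shows "mat_rank I' J' M' \<le> mat_rank I J M"
proof -
  obtain u v where "\<And>i j. i \<in> I \<Longrightarrow> j \<in> J \<Longrightarrow> M i j = (\<Sum>l<mat_rank I J M. u l i * v l j)"
    using mat_rank_factorization[OF assms(1)] by blast
  then have "mat_rank I' J' M' \<le> card {..<mat_rank I J M}"
    by (intro mat_rank_le_card[where u = "\<lambda>l i. u l (f i)" and v = "\<lambda>l j. v l (g j)"])
      (use assms in \<open>auto simp: image_subset_iff\<close>)
  then show ?thesis
    by simp
qed

lemma mat_rank_mono:
  assumes "finite J" "I' \<subseteq> I" "J' \<subseteq> J"
  shows "mat_rank I' J' M \<le> mat_rank I J M"
  using assms by (intro mat_rank_reindex_le[where f = id and g = id]) auto

lemma mat_rank_add_le:
  assumes "finite J" "\<And>i j. i \<in> I \<Longrightarrow> j \<in> J \<Longrightarrow> M i j = M1 i j + M2 i j"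
  shows "mat_rank I J M \<le> mat_rank I J M1 + mat_rank I J M2"
proof -
  let ?r1 = "mat_rank I J M1" and ?r2 = "mat_rank I J M2"
  obtain u1 v1 where M1: "\<And>i j. i \<in> I \<Longrightarrow> j \<in> J \<Longrightarrow> M1 i j = (\<Sum>l<?r1. u1 l i * v1 l j)"
    using mat_rank_factorization[OF assms(1)] by blast
  obtain u2 v2 where M2: "\<And>i j. i \<in> I \<Longrightarrow> j \<in> J \<Longrightarrow> M2 i j = (\<Sum>l<?r2. u2 l i * v2 l j)"
    using mat_rank_factorization[OF assms(1)] by blast
  have "mat_rank I J M \<le> card ({..<?r1} <+> {..<?r2})"
    by (rule mat_rank_le_card[where u = "case_sum u1 u2" and v = "case_sum v1 v2"])
      (simp_all add: assms(2) M1 M2 sum.Plus)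
  then show ?thesis
    by (simp add: card_Plus)
qed

lemma mat_rank_transpose_le:
  assumes "finite I" "finite J"
  shows "mat_rank J I (\<lambda>j i. M i j) \<le> mat_rank I J M"
proof -
  obtain u v where "\<And>i j. i \<in> I \<Longrightarrow> j \<in> J \<Longrightarrow> M i j = (\<Sum>l<mat_rank I J M. u l i * v l j)"
    using mat_rank_factorization[OF assms(2)] by blast
  then have "mat_rank J I (\<lambda>j i. M i j) \<le> card {..<mat_rank I J M}"
    by (intro mat_rank_le_card[where u = v and v = u]) (auto simp: mult.commute)
  then show ?thesis
    by simp
qed

lemma mat_rank_column_operation_le:
  assumes "finite J" "q \<in> J"
  shows "mat_rank I J (\<lambda>i j. M i j - M i q * w j) \<le> mat_rank I J M"
proof -
  obtain u v where "\<And>i j. i \<in> I \<Longrightarrow> j \<in> J \<Longrightarrow> M i j = (\<Sum>l<mat_rank I J M. u l i * v l j)"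
    using mat_rank_factorization[OF assms(1)] by blast
  then have "mat_rank I J (\<lambda>i j. M i j - M i q * w j) \<le> card {..<mat_rank I J M}"
    using assms(2) by (intro mat_rank_le_card[where u = u and v = "\<lambda>l j. v l j - v l q * w j"])
      (simp_all add: algebra_simps sum_subtractf sum_distrib_left)
  then show ?thesis
    by simp
qed

lemma mat_rank_identity_ge:
  assumes "finite X"
  shows "card X \<le> mat_rank X X (\<lambda>x y. of_bool (x = y) :: 'b::field)"
proof -
  have "(\<Sum>j\<in>X. \<alpha> j * of_bool (i = j)) = \<alpha> i" if "i \<in> X" for \<alpha> :: "_ \<Rightarrow> 'b" and i
    using that assms by (simp add: of_bool_def if_distrib sum.delta cong: if_cong)
  then have "independent_columns X X (\<lambda>x y. of_bool (x = y) :: 'b)"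
    by (intro independent_columnsI) fastforce
  then show ?thesis
    using assms by (intro card_le_mat_rank) auto
qed

lemma mat_rank_singleton:
  assumes "M p q \<noteq> 0"
  shows "1 \<le> mat_rank {p} {q} M"
proof -
  have "independent_columns {p} {q} M"
    by (rule independent_columnsI) (use assms in auto)
  from card_le_mat_rank[OF _ _ this, of "{q}"] show ?thesis
    by simp
qed

lemma independent_columns_nonzero:
  assumes "independent_columns I Y M" "q \<in> Y"
  shows "\<exists>i\<in>I. M i q \<noteq> 0"
proof (rule ccontr)
  assume "\<not> (\<exists>i\<in>I. M i q \<noteq> 0)"
  then have "(\<Sum>j\<in>Y. of_bool (j = q) * M i j) = 0" if "i \<in> I" for i
    using that by (intro sum.neutral) auto
  then show False
    using independent_columnsD[OF assms(1) _ assms(2), of "\<lambda>j. of_bool (j = q)"] by simp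
qed

lemma independent_columns_block_triangular:
  assumes "finite Y1" "finite Y2" "Y1 \<inter> Y2 = {}"
    and indep: "independent_columns I1 Y1 M" "independent_columns I2 Y2 M"
    and zero: "\<And>i j. i \<in> I1 \<Longrightarrow> j \<in> Y2 \<Longrightarrow> M i j = 0"
  shows "independent_columns (I1 \<union> I2) (Y1 \<union> Y2) M"
proof (rule independent_columnsI)
  fix \<alpha> j assume "\<And>i. i \<in> I1 \<union> I2 \<Longrightarrow> (\<Sum>j\<in>Y1 \<union> Y2. \<alpha> j * M i j) = 0" and "j \<in> Y1 \<union> Y2"
  then have split: "(\<Sum>j\<in>Y1. \<alpha> j * M i j) + (\<Sum>j\<in>Y2. \<alpha> j * M i j) = 0" if "i \<in> I1 \<union> I2" for i
    using that assms(1-3) by (simp add: sum.union_disjoint)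
  have "(\<Sum>j\<in>Y1. \<alpha> j * M i j) = 0" if "i \<in> I1" for i
    using split[of i] zero[OF that] that by simp
  then have zero_Y1: "\<alpha> j = 0" if "j \<in> Y1" for j
    by (rule independent_columnsD[OF indep(1) _ that])
  then have "(\<Sum>j\<in>Y2. \<alpha> j * M i j) = 0" if "i \<in> I2" for i
    using split[of i] that by simp
  then have "\<alpha> j = 0" if "j \<in> Y2" for j
    by (rule independent_columnsD[OF indep(2) _ that])
  then show "\<alpha> j = 0"
    using zero_Y1 \<open>j \<in> Y1 \<union> Y2\<close> by blast
qed

lemma mat_rank_block_triangular:
  assumes "finite J1" "finite J2" and zero: "\<And>i j. i \<in> I1 \<Longrightarrow> j \<in> J2 \<Longrightarrow> M i j = 0"
  shows "mat_rank I1 J1 M + mat_rank I2 J2 M \<le> mat_rank (I1 \<union> I2) (J1 \<union> J2) M"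
proof -
  obtain Y1 where Y1: "Y1 \<subseteq> J1" "finite Y1" "card Y1 = mat_rank I1 J1 M"
      "independent_columns I1 Y1 M"
    using obtain_independent_columns[OF assms(1)] by metis
  obtain Y2 where Y2: "Y2 \<subseteq> J2" "finite Y2" "card Y2 = mat_rank I2 J2 M"
      "independent_columns I2 Y2 M"
    using obtain_independent_columns[OF assms(2)] by metis
  have disj: "Y1 \<inter> Y2 = {}"
    using independent_columns_nonzero[OF Y1(4)] zero Y2(1) by blast
  have "independent_columns (I1 \<union> I2) (Y1 \<union> Y2) M"
    using Y1 Y2 disj zero by (intro independent_columns_block_triangular) auto
  then have "card (Y1 \<union> Y2) \<le> mat_rank (I1 \<union> I2) (J1 \<union> J2) M"
    using assms Y1(1) Y2(1) by (intro card_le_mat_rank) auto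
  then show ?thesis
    using Y1 Y2 disj by (simp add: card_Un_disjoint)
qed

lemma sum_mat_rank_le_block_triangular:
  fixes I :: "'a::linorder \<Rightarrow> 'i set"
  assumes "finite B" "\<And>b. b \<in> B \<Longrightarrow> finite (J b)"
    and "\<And>b c i j. b \<in> B \<Longrightarrow> c \<in> B \<Longrightarrow> b < c \<Longrightarrow> i \<in> I b \<Longrightarrow> j \<in> J c \<Longrightarrow> M i j = 0"
  shows "(\<Sum>b\<in>B. mat_rank (I b) (J b) M) \<le> mat_rank (\<Union>b\<in>B. I b) (\<Union>b\<in>B. J b) M"
  using assms
proof (induction B rule: finite_linorder_max_induct)
  case empty
  then show ?case by simp
next
  case (insert c B)
  have "(\<Sum>b\<in>insert c B. mat_rank (I b) (J b) M) =
      (\<Sum>b\<in>B. mat_rank (I b) (J b) M) + mat_rank (I c) (J c) M"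
    using insert.hyps by (subst sum.insert) auto
  also have "\<dots> \<le> mat_rank (\<Union>b\<in>B. I b) (\<Union>b\<in>B. J b) M + mat_rank (I c) (J c) M"
    by (intro add_right_mono insert.IH insert.prems) auto
  also have "\<dots> \<le> mat_rank ((\<Union>b\<in>B. I b) \<union> I c) ((\<Union>b\<in>B. J b) \<union> J c) M"
  proof (rule mat_rank_block_triangular)
    show "M i j = 0" if "i \<in> (\<Union>b\<in>B. I b)" "j \<in> J c" for i j
      using that insert.hyps(2) insert.prems(2)[of _ c i j] by blast
  qed (use insert.hyps insert.prems in auto)
  also have "\<dots> = mat_rank (\<Union>b\<in>insert c B. I b) (\<Union>b\<in>insert c B. J b) M"
    by (simp add: Un_commute)
  finally show ?case .
qed

lemma mat_rank_schur_complement: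
  assumes "finite J" "p \<in> I" "q \<in> J" "M p q \<noteq> 0"
  shows "mat_rank (I - {p}) (J - {q}) (\<lambda>i j. M i j - M i q * M p j / M p q) + 1 \<le> mat_rank I J M"
proof -
  let ?S = "\<lambda>i j. M i j - M i q * M p j / M p q"
  define w where "w j = (if j = q then 0 else M p j / M p q)" for j
  define M' where "M' i j = M i j - M i q * w j" for i j
  have "mat_rank (I - {p}) (J - {q}) ?S + 1 \<le>
      mat_rank {p} {q} M' + mat_rank (I - {p}) (J - {q}) M'"
  proof -
    have "1 \<le> mat_rank {p} {q} M'"
      using assms(4) by (intro mat_rank_singleton) (simp add: M'_def w_def)
    moreover have "mat_rank (I - {p}) (J - {q}) ?S \<le> mat_rank (I - {p}) (J - {q}) M'"
      using assms(1) by (intro mat_rank_reindex_le[where f = id and g = id])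
        (auto simp: M'_def w_def)
    ultimately show ?thesis
      by linarith
  qed
  also have "\<dots> \<le> mat_rank ({p} \<union> (I - {p})) ({q} \<union> (J - {q})) M'"
    using assms(1,4) by (intro mat_rank_block_triangular) (auto simp: M'_def w_def)
  also have "\<dots> = mat_rank I J M'"
    using assms(2,3) by (simp add: insert_absorb)
  also have "\<dots> \<le> mat_rank I J M"
    unfolding M'_def using assms(1,3) by (rule mat_rank_column_operation_le)
  finally show ?thesis .
qed

lemma mat_rank_strict_upper_le:
  fixes f :: "'a::linorder \<Rightarrow> 'a \<Rightarrow> 'b::field"
  assumes "finite W"
  shows "mat_rank W W (\<lambda>b c. if b < c then f b c else 0) \<le> card W - 1"
proof -
  let ?M = "\<lambda>b c. if b < c then f b c else 0"
  have "mat_rank W W ?M \<le> card (W - {Min W})"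
  proof (rule mat_rank_le_card[where u = "\<lambda>d b. ?M b d" and v = "\<lambda>d c. of_bool (d = c)"])
    fix b c assume "b \<in> W" "c \<in> W"
    have "(\<Sum>d\<in>W - {Min W}. ?M b d * of_bool (d = c)) = (if c \<in> W - {Min W} then ?M b c else 0)"
      using assms by (simp add: of_bool_def if_distrib[of "\<lambda>x. _ * x"] cong: if_cong)
    also have "\<dots> = ?M b c"
      using assms \<open>b \<in> W\<close> \<open>c \<in> W\<close> leD[OF Min_le[OF assms \<open>b \<in> W\<close>]] by auto
    finally show "?M b c = (\<Sum>d\<in>W - {Min W}. ?M b d * of_bool (d = c))" ..
  qed (use assms in auto)
  also have "\<dots> = card W - 1"
    using assms by (cases "W = {}") auto
  finally show ?thesis .
qed

section \<open>Tournament matrices and block matrices\<close>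

lemma bit_add_self [simp]: "a + a = 0" for a :: bit
  by (cases a) auto

definition tournament_matrix_on :: "'a set \<Rightarrow> ('a \<Rightarrow> 'a \<Rightarrow> bit) \<Rightarrow> bool" where
  "tournament_matrix_on X V \<longleftrightarrow> (\<forall>x\<in>X. \<forall>y\<in>X. x \<noteq> y \<longrightarrow> V x y + V y x = 1)"

lemma card_le_mat_rank_tournament:
  assumes "finite X" "tournament_matrix_on X V"
  shows "card X \<le> 2 * mat_rank X X V + 1"
proof -
  have "card X \<le> mat_rank X X (\<lambda>x y. of_bool (x = y) :: bit)"
    using assms(1) by (rule mat_rank_identity_ge)
  also have "\<dots> \<le> mat_rank X X (\<lambda>x y. V x y + V y x) + mat_rank X X (\<lambda>_ _. 1 :: bit)"
    using assms by (intro mat_rank_add_le) (auto simp: of_bool_def tournament_matrix_on_def)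
  also have "mat_rank X X (\<lambda>x y. V x y + V y x) \<le> mat_rank X X V + mat_rank X X (\<lambda>x y. V y x)"
    using assms(1) by (rule mat_rank_add_le) simp
  also have "mat_rank X X (\<lambda>x y. V y x) \<le> mat_rank X X V"
    using assms(1) assms(1) by (rule mat_rank_transpose_le)
  also have "mat_rank X X (\<lambda>_ _. 1 :: bit) \<le> card {()}"
    by (rule mat_rank_le_card[where u = "\<lambda>_ _. 1" and v = "\<lambda>_ _. 1"]) auto
  finally show ?thesis
    by simp
qed

text \<open>Rows and columns are pairs \<open>(b, x)\<close> of a block \<open>b\<close> and a position \<open>x\<close> in it.\<close>

definition tournament_blocks ::
    "('b::linorder \<times> 'a) set \<Rightarrow> ('b \<times> 'a) set \<Rightarrow> ('b \<times> 'a \<Rightarrow> 'b \<times> 'a \<Rightarrow> bit) \<Rightarrow> bool" where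
  "tournament_blocks I J N \<longleftrightarrow>
     (\<forall>i\<in>I. \<forall>j\<in>J. fst i < fst j \<and> snd i \<noteq> snd j \<longrightarrow> N i j = 0) \<and>
     (\<forall>b. tournament_matrix_on {i \<in> I \<inter> J. fst i = b} N)"

lemma tournament_blocks_mono:
  assumes "tournament_blocks I J N" "I' \<subseteq> I" "J' \<subseteq> J"
    and "\<And>i j. i \<in> I' \<Longrightarrow> j \<in> J' \<Longrightarrow> fst i \<le> fst j \<Longrightarrow> snd i \<noteq> snd j \<Longrightarrow> N' i j = N i j"
  shows "tournament_blocks I' J' N'"
  unfolding tournament_blocks_def tournament_matrix_on_def
proof (intro conjI ballI allI impI)
  fix i j assume ij: "i \<in> I'" "j \<in> J'" "fst i < fst j \<and> snd i \<noteq> snd j"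
  then have "N' i j = N i j"
    by (intro assms(4)) auto
  also have "\<dots> = 0"
    using assms(1-3) ij unfolding tournament_blocks_def by blast
  finally show "N' i j = 0" .
next
  fix b i j assume ij: "i \<in> {i \<in> I' \<inter> J'. fst i = b}" "j \<in> {i \<in> I' \<inter> J'. fst i = b}" "i \<noteq> j"
  then have "snd i \<noteq> snd j"
    by (auto simp: prod_eq_iff)
  then have "N' i j + N' j i = N i j + N j i"
    using ij by (simp add: assms(4))
  also have "\<dots> = 1"
    using assms(1-3) ij unfolding tournament_blocks_def tournament_matrix_on_def by blast
  finally show "N' i j + N' j i = 1" .
qed

lemma card_le_mat_rank_tournament_blocks_triangular:
  assumes fin: "finite I" "finite J" and blocks: "tournament_blocks I J N"
    and triangular: "\<And>i j. i \<in> I \<Longrightarrow> j \<in> J \<Longrightarrow> fst i < fst j \<Longrightarrow> N i j = 0"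
  shows "card (I \<inter> J) \<le> 2 * mat_rank I J N + card (fst ` (I \<inter> J))"
proof -
  let ?B = "fst ` (I \<inter> J)" and ?K = "\<lambda>b. {i \<in> I \<inter> J. fst i = b}"
  have finite_block: "finite (?K b)" for b
    using fin by simp
  have "card (I \<inter> J) = (\<Sum>b\<in>?B. card (?K b))"
    using fin sum.group[of "I \<inter> J" ?B fst "\<lambda>_. 1 :: nat"] by simp
  also have "\<dots> \<le> (\<Sum>b\<in>?B. 2 * mat_rank (?K b) (?K b) N + 1)"
    using blocks finite_block by (intro sum_mono card_le_mat_rank_tournament)
      (auto simp: tournament_blocks_def)
  also have "\<dots> = 2 * (\<Sum>b\<in>?B. mat_rank (?K b) (?K b) N) + card ?B"
    unfolding sum.distrib sum_distrib_left[symmetric] by simp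
  also have "(\<Sum>b\<in>?B. mat_rank (?K b) (?K b) N) \<le> mat_rank (\<Union>b\<in>?B. ?K b) (\<Union>b\<in>?B. ?K b) N"
    using fin triangular by (intro sum_mat_rank_le_block_triangular) auto
  also have "\<dots> \<le> mat_rank I J N"
    using fin by (intro mat_rank_mono) auto
  finally show ?thesis
    by simp
qed

lemma obtain_corner_above_block_diagonal:
  fixes N :: "'b::linorder \<times> 'a \<Rightarrow> 'b \<times> 'a \<Rightarrow> 'c::zero"
  assumes "finite I" "finite J" "i \<in> I" "j \<in> J" "fst i < fst j" "N i j \<noteq> 0"
  obtains p q where "p \<in> I" "q \<in> J" "fst p < fst q" "N p q \<noteq> 0"
    and "\<forall>i\<in>I. fst i < fst p \<longrightarrow> N i q = 0"
    and "\<forall>j\<in>J. fst q < fst j \<longrightarrow> N p j = 0"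
proof -
  let ?rows = "{i \<in> I. \<exists>j\<in>J. fst i < fst j \<and> N i j \<noteq> 0}"
  have rows: "finite (fst ` ?rows)" "fst ` ?rows \<noteq> {}"
    using assms by (simp, blast)
  obtain p where p: "p \<in> ?rows" and p_min: "fst p = Min (fst ` ?rows)"
    using Min_in[OF rows] by fastforce
  let ?columns = "{j \<in> J. fst p < fst j \<and> N p j \<noteq> 0}"
  have columns: "finite (fst ` ?columns)" "fst ` ?columns \<noteq> {}"
    using p assms(2) by auto
  obtain q where q: "q \<in> ?columns" and q_max: "fst q = Max (fst ` ?columns)"
    using Max_in[OF columns] by fastforce
  show ?thesis
  proof (rule that)
    show "p \<in> I" "q \<in> J" "fst p < fst q" "N p q \<noteq> 0"
      using p q by auto
    have "fst p \<le> fst i" if "i \<in> ?rows" for i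
      unfolding p_min using rows(1) that by (intro Min_le) auto
    then show "\<forall>i\<in>I. fst i < fst p \<longrightarrow> N i q = 0"
      using q by fastforce
    have "fst j \<le> fst q" if "j \<in> ?columns" for j
      unfolding q_max using columns(1) that by (intro Max_ge) auto
    then show "\<forall>j\<in>J. fst q < fst j \<longrightarrow> N p j = 0"
      using q by fastforce
  qed
qed

lemma corner_product_eq_0:
  fixes N :: "'b::linorder \<times> 'a \<Rightarrow> 'b \<times> 'a \<Rightarrow> 'c::semiring_0"
  assumes diagonal: "\<And>i j. i \<in> I \<Longrightarrow> j \<in> J \<Longrightarrow> fst i < fst j \<Longrightarrow> N i j \<noteq> 0 \<Longrightarrow> snd i = snd j"
    and pq: "p \<in> I" "q \<in> J" "fst p < fst q" "N p q \<noteq> 0"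
    and corner: "\<forall>i\<in>I. fst i < fst p \<longrightarrow> N i q = 0" "\<forall>j\<in>J. fst q < fst j \<longrightarrow> N p j = 0"
    and ij: "i \<in> I - {p}" "j \<in> J - {q}" "fst i \<le> fst j" "snd i \<noteq> snd j"
  shows "N i q * N p j = 0"
proof (rule ccontr)
  assume "N i q * N p j \<noteq> 0"
  then have nonzero: "N i q \<noteq> 0" "N p j \<noteq> 0"
    by auto
  then have "fst p \<le> fst i" "fst j \<le> fst q"
    using corner ij(1,2) by (meson DiffD1 not_le)+
  then consider (interior) "fst p < fst j" "fst i < fst q"
    | (pivot_row) "fst i = fst p" "fst i < fst q"
    | (pivot_column) "fst j = fst q" "fst p < fst j"
    using pq(3) ij(3) by fastforce
  then show False
  proof cases
    case interior
    then have "snd p = snd j" "snd i = snd q" "snd p = snd q"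
      using pq ij nonzero by (auto intro!: diagonal)
    then show ?thesis
      using ij(4) by simp
  next
    case pivot_row
    then have "snd i = snd q" "snd p = snd q"
      using pq ij nonzero by (auto intro!: diagonal)
    with pivot_row(1) ij(1) show ?thesis
      by (simp add: prod_eq_iff)
  next
    case pivot_column
    then have "snd p = snd j" "snd p = snd q"
      using pq ij nonzero by (auto intro!: diagonal)
    with pivot_column(1) ij(2) show ?thesis
      by (simp add: prod_eq_iff)
  qed
qed

text \<open>
  Clearing row and column of a corner may destroy entries below the block diagonal or at equal
  positions, but nothing is assumed about those.
\<close>

lemma tournament_blocks_schur_complement:
  assumes blocks: "tournament_blocks I J N" and pq: "p \<in> I" "q \<in> J" "fst p < fst q" "N p q \<noteq> 0"
    and corner: "\<forall>i\<in>I. fst i < fst p \<longrightarrow> N i q = 0" "\<forall>j\<in>J. fst q < fst j \<longrightarrow> N p j = 0"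
  shows "tournament_blocks (I - {p}) (J - {q}) (\<lambda>i j. N i j - N i q * N p j / N p q)"
proof (rule tournament_blocks_mono[OF blocks])
  have diagonal: "snd i = snd j" if "i \<in> I" "j \<in> J" "fst i < fst j" "N i j \<noteq> 0" for i j
    using blocks that unfolding tournament_blocks_def by blast
  fix i j assume ij: "i \<in> I - {p}" "j \<in> J - {q}" "fst i \<le> fst j" "snd i \<noteq> snd j"
  have "N i q * N p j = 0"
    using diagonal pq corner ij by (rule corner_product_eq_0)
  then show "N i j - N i q * N p j / N p q = N i j"
    by simp
qed auto

text \<open>
  Each elimination step gains \<open>1\<close> in the rank and costs at most two of the indices in \<open>I \<inter> J\<close>.
\<close>

lemma card_le_mat_rank_tournament_blocks:
  assumes "finite I" "finite J" "tournament_blocks I J N"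
  shows "card (I \<inter> J) \<le> 2 * mat_rank I J N + card (fst ` (I \<inter> J))"
  using assms
proof (induction "card I" arbitrary: I J N rule: less_induct)
  case less
  note fin = less.prems(1,2)
  show ?case
  proof (cases "\<exists>i\<in>I. \<exists>j\<in>J. fst i < fst j \<and> N i j \<noteq> 0")
    case False
    with less.prems show ?thesis
      by (intro card_le_mat_rank_tournament_blocks_triangular) auto
  next
    case True
    then obtain p q where pq: "p \<in> I" "q \<in> J" "fst p < fst q" "N p q \<noteq> 0"
      and corner: "\<forall>i\<in>I. fst i < fst p \<longrightarrow> N i q = 0" "\<forall>j\<in>J. fst q < fst j \<longrightarrow> N p j = 0"
      using obtain_corner_above_block_diagonal[OF fin, of _ _ N thesis] by blast
    let ?I = "I - {p}" and ?J = "J - {q}" and ?N = "\<lambda>i j. N i j - N i q * N p j / N p q"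
    have "I \<inter> J \<subseteq> {p, q} \<union> (?I \<inter> ?J)"
      by blast
    then have "card (I \<inter> J) \<le> card ({p, q} \<union> (?I \<inter> ?J))"
      using fin by (intro card_mono) auto
    also have "\<dots> \<le> 2 + card (?I \<inter> ?J)"
      by (rule order.trans[OF card_Un_le]) (simp add: card_insert_if)
    also have "card (?I \<inter> ?J) \<le> 2 * mat_rank ?I ?J ?N + card (fst ` (?I \<inter> ?J))"
    proof (rule less.hyps)
      show "card ?I < card I"
        using fin(1) pq(1) by (rule card_Diff1_less)
      show "tournament_blocks ?I ?J ?N"
        using less.prems(3) pq corner by (rule tournament_blocks_schur_complement)
    qed (use fin in auto)
    also have "card (fst ` (?I \<inter> ?J)) \<le> card (fst ` (I \<inter> J))"
      using fin by (intro card_mono image_mono) auto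
    also have "2 + (2 * mat_rank ?I ?J ?N + card (fst ` (I \<inter> J)))
        \<le> 2 * mat_rank I J N + card (fst ` (I \<inter> J))"
      using mat_rank_schur_complement[of J p I q N] fin(2) pq by simp
    finally show ?thesis
      by simp
  qed
qed

section \<open>Forms on edges\<close>

definition edge_cocycle :: "'v set \<Rightarrow> ('v set \<Rightarrow> bit) \<Rightarrow> bool" where
  "edge_cocycle V f \<longleftrightarrow>
     (\<forall>a\<in>V. \<forall>b\<in>V. \<forall>c\<in>V. distinct [a, b, c] \<longrightarrow> f {a, b} = f {c, a} + f {c, b})"

lemma edge_cocycleD:
  "edge_cocycle V f \<Longrightarrow> {a, b, c} \<subseteq> V \<Longrightarrow> distinct [a, b, c] \<Longrightarrow> f {a, b} = f {c, a} + f {c, b}"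
  by (simp add: edge_cocycle_def)

lemma edge_cocycle_cong:
  assumes "\<And>S. S \<in> [V]\<^bsup>2\<^esup> \<Longrightarrow> f S = g S"
  shows "edge_cocycle V f \<longleftrightarrow> edge_cocycle V g"
  unfolding edge_cocycle_def by (auto simp: assms)

lemma edge_cocycle_add:
  assumes "edge_cocycle V f" "edge_cocycle V g"
  shows "edge_cocycle V (\<lambda>S. f S + g S)"
  unfolding edge_cocycle_def
proof (intro ballI impI)
  fix a b c assume "a \<in> V" "b \<in> V" "c \<in> V" "distinct [a, b, c]"
  then have "f {a, b} = f {c, a} + f {c, b}" "g {a, b} = g {c, a} + g {c, b}"
    using assms by (auto intro: edge_cocycleD)
  then show "f {a, b} + g {a, b} = f {c, a} + g {c, a} + (f {c, b} + g {c, b})"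
    by (simp add: algebra_simps)
qed

definition edge_form :: "'v set \<Rightarrow> ('v set \<Rightarrow> 'v set \<Rightarrow> bit) \<Rightarrow> bool" where
  "edge_form V \<phi> \<longleftrightarrow>
     (\<forall>S\<in>[V]\<^bsup>2\<^esup>. edge_cocycle V (\<phi> S) \<and> edge_cocycle V (\<lambda>T. \<phi> T S)) \<and>
     (\<forall>S\<in>[V]\<^bsup>2\<^esup>. \<forall>T\<in>[V]\<^bsup>2\<^esup>. S \<inter> T = {} \<longrightarrow> \<phi> S T = 0)"

lemma edge_form_transpose: "edge_form V \<phi> \<Longrightarrow> edge_form V (\<lambda>S T. \<phi> T S)"
  by (auto simp: edge_form_def Int_commute)

lemma edge_form_move_right:
  assumes "edge_form V \<phi>" "{a, b, c, d} \<subseteq> V" "a \<notin> {b, c, d}" "b \<notin> {c, d}"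
  shows "\<phi> {a, b} {a, c} = \<phi> {a, b} {a, d}"
proof (cases "c = d")
  case False
  have "\<phi> {a, b} {c, d} = 0"
    using assms False unfolding edge_form_def by auto
  moreover have "edge_cocycle V (\<phi> {a, b})"
    using assms unfolding edge_form_def by auto
  then have "\<phi> {a, b} {c, d} = \<phi> {a, b} {a, c} + \<phi> {a, b} {a, d}"
    using assms(2-4) False by (intro edge_cocycleD) auto
  ultimately show ?thesis
    by (cases "\<phi> {a, b} {a, c}"; cases "\<phi> {a, b} {a, d}") auto
qed simp

lemma edge_form_const:
  assumes \<phi>: "edge_form V \<phi>" and "4 \<le> card V" and mem: "{a, b, c, b', c'} \<subseteq> V"
    and bc: "distinct [a, b, c]" and bc': "distinct [a, b', c']"
  shows "\<phi> {a, b} {a, c} = \<phi> {a, b'} {a, c'}"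
proof -
  have move_right: "\<phi> {a, x} {a, y} = \<phi> {a, x} {a, z}"
    if "{x, y, z} \<subseteq> V" "a \<notin> {x, y, z}" "x \<notin> {y, z}" for x y z
    using edge_form_move_right[OF \<phi>, of a x y z] that mem by auto
  have move_left: "\<phi> {a, x} {a, z} = \<phi> {a, y} {a, z}"
    if "{x, y, z} \<subseteq> V" "a \<notin> {x, y, z}" "z \<notin> {x, y}" for x y z
    using edge_form_move_right[OF edge_form_transpose[OF \<phi>], of a z x y] that mem by auto
  show ?thesis
  proof (cases "b' = c")
    case False
    then have "\<phi> {a, b} {a, c} = \<phi> {a, b'} {a, c}"
      using mem bc bc' by (intro move_left) auto
    also have "\<dots> = \<phi> {a, b'} {a, c'}"
      using mem bc bc' False by (intro move_right) auto
    finally show ?thesis .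
  next
    case True
    have "card {a, b, c} < card V"
      using \<open>4 \<le> card V\<close> by (simp add: card_insert_if)
    then obtain d where d: "d \<in> V" "d \<notin> {a, b, c}"
      by (metis card_mono finite.emptyI finite.insertI not_less subsetI)
    have "\<phi> {a, b} {a, c} = \<phi> {a, b} {a, d}"
      using mem bc d by (intro move_right) auto
    also have "\<dots> = \<phi> {a, c} {a, d}"
      using mem bc d by (intro move_left) auto
    also have "\<dots> = \<phi> {a, b'} {a, c'}"
      unfolding True[symmetric] using mem bc' d True by (intro move_right) auto
    finally show ?thesis .
  qed
qed

section \<open>Forms on octahedra\<close>

abbreviation octahedra_on :: "'i set \<Rightarrow> 'v set \<Rightarrow> ('i \<Rightarrow> 'v set) set" where
  "octahedra_on I V \<equiv> I \<rightarrow>\<^sub>E [V]\<^bsup>2\<^esup>"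

lemma octahedra_on_extend:
  "P \<in> octahedra_on I V \<Longrightarrow> S \<in> [V]\<^bsup>2\<^esup> \<Longrightarrow> P(i := S) \<in> octahedra_on (insert i I) V"
  using PiE_fun_upd[of S "\<lambda>_. [V]\<^bsup>2\<^esup>" i P I] by simp

lemma octahedra_on_upd:
  "P \<in> octahedra_on I V \<Longrightarrow> S \<in> [V]\<^bsup>2\<^esup> \<Longrightarrow> i \<in> I \<Longrightarrow> P(i := S) \<in> octahedra_on I V"
  using octahedra_on_extend[of P I V S i] by (simp add: insert_absorb)

lemma finite_octahedra_on: "finite I \<Longrightarrow> finite V \<Longrightarrow> finite (octahedra_on I V)"
  by (intro finite_PiE finite_imp_finite_nsets)

locale octahedral_form =
  fixes I :: "'i set" and V :: "'v set" and A :: "('i \<Rightarrow> 'v set) \<Rightarrow> ('i \<Rightarrow> 'v set) \<Rightarrow> bit"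
  assumes entry_sym: "P \<in> octahedra_on I V \<Longrightarrow> Q \<in> octahedra_on I V \<Longrightarrow> A P Q = A Q P"
    and entry_disjoint: "P \<in> octahedra_on I V \<Longrightarrow> Q \<in> octahedra_on I V \<Longrightarrow>
      (\<And>i. i \<in> I \<Longrightarrow> P i \<inter> Q i = {}) \<Longrightarrow> A P Q = 0"
    and cocycle_left: "P \<in> octahedra_on I V \<Longrightarrow> Q \<in> octahedra_on I V \<Longrightarrow> i \<in> I \<Longrightarrow>
      edge_cocycle V (\<lambda>S. A (P(i := S)) Q)"
begin

lemma cocycle_right:
  assumes "P \<in> octahedra_on I V" "Q \<in> octahedra_on I V" "i \<in> I"
  shows "edge_cocycle V (\<lambda>S. A P (Q(i := S)))"
proof -
  have "A P (Q(i := S)) = A (Q(i := S)) P" if "S \<in> [V]\<^bsup>2\<^esup>" for S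
    using assms that by (intro entry_sym octahedra_on_upd)
  then show ?thesis
    using cocycle_left[OF assms(2,1,3)] by (simp cong: edge_cocycle_cong)
qed

end

lemma edge_form_of_octahedral_form:
  assumes "octahedral_form (insert j I) V A" "P \<in> octahedra_on I V" "Q \<in> octahedra_on I V"
    and disj: "\<And>i. i \<in> I \<Longrightarrow> P i \<inter> Q i = {}"
  shows "edge_form V (\<lambda>S T. A (P(j := S)) (Q(j := T)))"
proof -
  interpret octahedral_form "insert j I" V A
    by fact
  have "edge_cocycle V (\<lambda>T. A (P(j := S)) (Q(j := T))) \<and>
      edge_cocycle V (\<lambda>T. A (P(j := T)) (Q(j := S)))"
    if "S \<in> [V]\<^bsup>2\<^esup>" for S
    using cocycle_right[of "P(j := S)" "Q(j := S)" j] cocycle_left[of "P(j := S)" "Q(j := S)" j]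
      octahedra_on_extend[OF assms(2) that] octahedra_on_extend[OF assms(3) that] by simp
  moreover have "A (P(j := S)) (Q(j := T)) = 0" if "S \<in> [V]\<^bsup>2\<^esup>" "T \<in> [V]\<^bsup>2\<^esup>" "S \<inter> T = {}" for S T
  proof (rule entry_disjoint)
    show "(P(j := S)) i \<inter> (Q(j := T)) i = {}" if "i \<in> insert j I" for i
      using that \<open>S \<inter> T = {}\<close> disj[of i] by (cases "i = j") simp_all
  qed (use assms(2,3) that octahedra_on_extend in auto)
  ultimately show ?thesis
    unfolding edge_form_def by blast
qed

section \<open>Contraction of a coordinate\<close>

definition contract ::
    "'i \<Rightarrow> 'v set \<Rightarrow> 'v set \<Rightarrow> (('i \<Rightarrow> 'v set) \<Rightarrow> ('i \<Rightarrow> 'v set) \<Rightarrow> bit) \<Rightarrow>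
      ('i \<Rightarrow> 'v set) \<Rightarrow> ('i \<Rightarrow> 'v set) \<Rightarrow> bit" where
  "contract j S T A P Q = A (P(j := S)) (Q(j := T)) + A (P(j := T)) (Q(j := S))"

lemma octahedral_form_contract:
  assumes form: "octahedral_form (insert j I) V A" and j: "j \<notin> I" and card: "4 \<le> card V"
    and vertices: "{v, s, t} \<subseteq> V" "distinct [v, s, t]"
  shows "octahedral_form I V (contract j {v, s} {v, t} A)"
proof
  interpret octahedral_form "insert j I" V A
    by fact
  have edges: "{v, s} \<in> [V]\<^bsup>2\<^esup>" "{v, t} \<in> [V]\<^bsup>2\<^esup>"
    using vertices by auto
  fix P Q assume PQ: "P \<in> octahedra_on I V" "Q \<in> octahedra_on I V"
  note extend = octahedra_on_extend[OF PQ(1)] octahedra_on_extend[OF PQ(2)]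
  show "contract j {v, s} {v, t} A P Q = contract j {v, s} {v, t} A Q P"
    unfolding contract_def using entry_sym extend edges by (metis add.commute)
  show "contract j {v, s} {v, t} A P Q = 0" if "\<And>i. i \<in> I \<Longrightarrow> P i \<inter> Q i = {}"
  proof -
    have "A (P(j := {v, s})) (Q(j := {v, t})) = A (P(j := {v, t})) (Q(j := {v, s}))"
      using edge_form_const[OF edge_form_of_octahedral_form[OF form PQ that] card, of v s t t s]
        vertices by auto
    then show ?thesis
      by (simp add: contract_def)
  qed
  fix i assume i: "i \<in> I"
  have "edge_cocycle V (\<lambda>X. A ((P(i := X))(j := S)) (Q(j := T)))"
    if "S \<in> [V]\<^bsup>2\<^esup>" "T \<in> [V]\<^bsup>2\<^esup>" for S T
  proof -
    have "(P(i := X))(j := S) = (P(j := S))(i := X)" for X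
      using i j by (intro fun_upd_twist) auto
    then show ?thesis
      using cocycle_left[OF extend(1)[OF that(1)] extend(2)[OF that(2)], of i] i by simp
  qed
  then show "edge_cocycle V (\<lambda>X. contract j {v, s} {v, t} A (P(i := X)) Q)"
    unfolding contract_def using edges by (intro edge_cocycle_add) auto
qed

lemma mat_rank_contract_le:
  fixes V :: "'v set" and A :: "('i \<Rightarrow> 'v set) \<Rightarrow> ('i \<Rightarrow> 'v set) \<Rightarrow> bit"
  assumes "finite I" "finite V" "S \<in> [V]\<^bsup>2\<^esup>" "T \<in> [V]\<^bsup>2\<^esup>"
  shows "mat_rank (octahedra_on I V) (octahedra_on I V) (contract j S T A)
    \<le> 2 * mat_rank (octahedra_on (insert j I) V) (octahedra_on (insert j I) V) A"
proof -
  let ?O = "octahedra_on I V" and ?O' = "octahedra_on (insert j I) V"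
  define slice where "slice X Y P Q = A (P(j := X)) (Q(j := Y))" for X Y P Q
  have slice_le: "mat_rank ?O ?O (slice X Y) \<le> mat_rank ?O' ?O' A"
    if "X \<in> [V]\<^bsup>2\<^esup>" "Y \<in> [V]\<^bsup>2\<^esup>" for X Y
  proof (rule mat_rank_reindex_le)
    show "finite ?O'"
      using assms by (intro finite_octahedra_on) auto
    show "(\<lambda>P. P(j := X)) ` ?O \<subseteq> ?O'" "(\<lambda>P. P(j := Y)) ` ?O \<subseteq> ?O'"
      by (simp_all add: image_subset_iff octahedra_on_extend that)
  qed (simp add: slice_def)
  have "mat_rank ?O ?O (contract j S T A) \<le> mat_rank ?O ?O (slice S T) + mat_rank ?O ?O (slice T S)"
    using finite_octahedra_on[OF assms(1,2)]
    by (rule mat_rank_add_le) (simp add: contract_def slice_def)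
  also have "\<dots> \<le> 2 * mat_rank ?O' ?O' A"
    using slice_le[OF assms(3,4)] slice_le[OF assms(4,3)] by simp
  finally show ?thesis .
qed

definition flip :: "'v set \<Rightarrow> 'v set \<Rightarrow> 'i set \<Rightarrow> ('i \<Rightarrow> 'v set) \<Rightarrow> 'i \<Rightarrow> 'v set" where
  "flip S T J P = (\<lambda>i\<in>J. transpose S T (P i))"

lemma flip_extend:
  "j \<notin> J \<Longrightarrow> flip S T (insert j J) (P(j := X)) = (flip S T J P)(j := transpose S T X)"
  by (auto simp: flip_def fun_eq_iff)

text \<open>
  Each unordered special pair has exactly one member with \<open>S\<close> in coordinate \<open>i\<close>; the sum runs over
  its remaining coordinates \<open>J\<close>.
\<close>

definition special_sum ::
    "'i \<Rightarrow> 'i set \<Rightarrow> 'v set \<Rightarrow> 'v set \<Rightarrow> (('i \<Rightarrow> 'v set) \<Rightarrow> ('i \<Rightarrow> 'v set) \<Rightarrow> bit) \<Rightarrow> bit" where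
  "special_sum i J S T A = (\<Sum>P\<in>J \<rightarrow>\<^sub>E {S, T}. A (P(i := S)) ((flip S T J P)(i := T)))"

lemma special_sum_empty:
  "special_sum i {} S T A = A ((\<lambda>_. undefined)(i := S)) ((\<lambda>_. undefined)(i := T))"
  by (simp add: special_sum_def flip_def restrict_def fun_upd_def)

lemma special_sum_contract:
  assumes "j \<notin> J" "i \<notin> insert j J" "S \<noteq> T"
  shows "special_sum i J S T (contract j S T A) = special_sum i (insert j J) S T A"
proof -
  let ?term = "\<lambda>P. A (P(i := S)) ((flip S T (insert j J) P)(i := T))"
  have twist: "P(j := X, i := Y) = P(i := Y, j := X)" for P :: "_ \<Rightarrow> 'b set" and X Y
    using assms(2) by (intro fun_upd_twist) auto
  have "special_sum i (insert j J) S T A = (\<Sum>(X, P)\<in>{S, T} \<times> (J \<rightarrow>\<^sub>E {S, T}). ?term (P(j := X)))"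
    unfolding special_sum_def PiE_insert_eq
    by (subst sum.reindex[OF inj_combinator[OF assms(1)]]) (simp add: case_prod_unfold)
  also have "\<dots> = (\<Sum>P\<in>J \<rightarrow>\<^sub>E {S, T}. ?term (P(j := S)) + ?term (P(j := T)))"
    using assms(3) by (simp add: sum.cartesian_product[symmetric] sum.distrib)
  also have "\<dots> = special_sum i J S T (contract j S T A)"
    by (simp add: special_sum_def contract_def flip_extend[OF assms(1)] twist)
  finally show ?thesis ..
qed

section \<open>Octahedra with two coordinates\<close>

text \<open>The vertices \<open>v\<close>, \<open>s\<close>, \<open>t\<close> play the roles of \<open>1\<close>, \<open>2\<close>, \<open>3\<close>.\<close>

locale square_form =
  fixes i j :: 'i and V :: "'v::linorder set" and A :: "('i \<Rightarrow> 'v set) \<Rightarrow> ('i \<Rightarrow> 'v set) \<Rightarrow> bit"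
    and v s t :: 'v
  assumes form: "octahedral_form {i, j} V A" and neq: "i \<noteq> j"
    and card: "4 \<le> card V" and vertices: "{v, s, t} \<subseteq> V" "distinct [v, s, t]"
    and normalized: "special_sum i {j} {v, s} {v, t} A = 1"
begin

sublocale octahedral_form "{i, j}" V A
  by (fact form)

lemma finite_vertices: "finite V"
  using card by (intro card_ge_0_finite) simp

definition join :: "'v set \<Rightarrow> 'v set \<Rightarrow> 'i \<Rightarrow> 'v set"  (infixl \<open>\<star>\<close> 75) where
  "S \<star> T = (\<lambda>_. undefined)(i := S, j := T)"

lemma join_in_octahedra_on: "S \<in> [V]\<^bsup>2\<^esup> \<Longrightarrow> T \<in> [V]\<^bsup>2\<^esup> \<Longrightarrow> S \<star> T \<in> octahedra_on {i, j} V"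
  unfolding join_def by (auto simp: PiE_iff extensional_def)

lemma upd_join: "(S \<star> T)(i := S') = S' \<star> T"
  using neq by (auto simp: join_def fun_eq_iff)

lemma join_twist: "S \<star> T = (\<lambda>_. undefined)(j := T, i := S)"
  using neq by (auto simp: join_def fun_eq_iff)

lemma edge_form_second:
  assumes "S \<in> [V]\<^bsup>2\<^esup>" "S' \<in> [V]\<^bsup>2\<^esup>" "S \<inter> S' = {}"
  shows "edge_form V (\<lambda>T T'. A (S \<star> T) (S' \<star> T'))"
  unfolding join_def
proof (rule edge_form_of_octahedral_form)
  show "octahedral_form (insert j {i}) V A"
    using form by (simp add: insert_commute)
qed (use assms in \<open>auto simp: PiE_iff extensional_def\<close>)

lemma edge_form_contract_first:
  assumes "{v, b, c} \<subseteq> V" "distinct [v, b, c]"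
  shows "edge_form V (\<lambda>T T'. A ({v, b} \<star> T) ({v, c} \<star> T') + A ({v, c} \<star> T) ({v, b} \<star> T'))"
proof -
  have "octahedral_form (insert j {}) V (contract i {v, b} {v, c} A)"
    using form neq card assms by (intro octahedral_form_contract) auto
  then have "edge_form V (\<lambda>T T'.
      contract i {v, b} {v, c} A ((\<lambda>_. undefined)(j := T)) ((\<lambda>_. undefined)(j := T')))"
    by (rule edge_form_of_octahedral_form) auto
  then show ?thesis
    by (simp add: contract_def join_twist)
qed

lemma edge_form_contract_second:
  assumes "{v, x, y} \<subseteq> V" "distinct [v, x, y]"
  shows "edge_form V (\<lambda>S S'. A (S \<star> {v, x}) (S' \<star> {v, y}) + A (S \<star> {v, y}) (S' \<star> {v, x}))"
proof -
  have "octahedral_form (insert j {i}) V A"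
    using form by (simp add: insert_commute)
  then have "octahedral_form (insert i {}) V (contract j {v, x} {v, y} A)"
    using neq card assms by (intro octahedral_form_contract) auto
  then have "edge_form V (\<lambda>S S'.
      contract j {v, x} {v, y} A ((\<lambda>_. undefined)(i := S)) ((\<lambda>_. undefined)(i := S')))"
    by (rule edge_form_of_octahedral_form) auto
  then show ?thesis
    by (simp add: contract_def join_def)
qed

lemma star_entries_add_swapped:
  assumes bc: "{b, c} \<subseteq> V - {v}" "b \<noteq> c" and xy: "{x, y} \<subseteq> V - {v}" "x \<noteq> y"
  shows "A ({v, b} \<star> {v, x}) ({v, c} \<star> {v, y}) + A ({v, b} \<star> {v, y}) ({v, c} \<star> {v, x}) = 1"
proof -
  have swap_pair: "A ({v, c} \<star> {v, x}) ({v, b} \<star> {v, y}) = A ({v, b} \<star> {v, y}) ({v, c} \<star> {v, x})"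
    if "{x, y} \<subseteq> V - {v}" for x y
    using that bc vertices by (intro entry_sym join_in_octahedra_on) auto
  have "A ({v, b} \<star> {v, x}) ({v, c} \<star> {v, y}) + A ({v, b} \<star> {v, y}) ({v, c} \<star> {v, x}) =
      A ({v, b} \<star> {v, s}) ({v, c} \<star> {v, t}) + A ({v, b} \<star> {v, t}) ({v, c} \<star> {v, s})"
    using edge_form_const[OF edge_form_contract_first card, of b c v x y s t] bc xy vertices
    by (auto simp: swap_pair)
  also have "\<dots> = A ({v, s} \<star> {v, s}) ({v, t} \<star> {v, t}) + A ({v, s} \<star> {v, t}) ({v, t} \<star> {v, s})"
    using edge_form_const[OF edge_form_contract_second card, of s t v b c s t] bc vertices by auto
  also have "\<dots> = special_sum i (insert j {}) {v, s} {v, t} A"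
    using neq vertices by (subst special_sum_contract[symmetric])
      (auto simp: special_sum_empty contract_def join_def doubleton_eq_iff)
  finally show ?thesis
    using normalized by simp
qed

abbreviation indices :: "('v \<times> 'v) set" where
  "indices \<equiv> (V - {v, s}) \<times> (V - {v})"

definition block_matrix :: "'v \<times> 'v \<Rightarrow> 'v \<times> 'v \<Rightarrow> bit" where
  "block_matrix = (\<lambda>(b, x) (c, y). A ({s, b} \<star> {v, x}) ({v, c} \<star> {v, y}))"

lemma block_matrix_off_diagonal:
  assumes "b \<in> V - {v, s}" "c \<in> V - {v, s}" "b \<noteq> c" "{x, y} \<subseteq> V - {v}" "x \<noteq> y"
  shows "block_matrix (b, x) (c, y) = block_matrix (b, s) (c, t)"
  unfolding block_matrix_def prod.case using assms vertices
  by (intro edge_form_const[OF edge_form_second card]) auto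

lemma block_matrix_diagonal:
  assumes b: "b \<in> V - {v, s}" and xy: "{x, y} \<subseteq> V - {v}" "x \<noteq> y"
  shows "block_matrix (b, x) (b, y) + block_matrix (b, y) (b, x) = 1"
proof -
  have block: "block_matrix (b, x) (b, y) =
      A ({v, s} \<star> {v, x}) ({v, b} \<star> {v, y}) + A ({v, b} \<star> {v, x}) ({v, b} \<star> {v, y})"
    if "{x, y} \<subseteq> V - {v}" for x y
  proof -
    have "edge_cocycle V (\<lambda>S. A (S \<star> {v, x}) ({v, b} \<star> {v, y}))"
      using cocycle_left[of "{v, b} \<star> {v, x}" "{v, b} \<star> {v, y}" i] b that vertices
      by (auto simp: upd_join join_in_octahedra_on)
    then show ?thesis
      unfolding block_matrix_def prod.case using b vertices by (intro edge_cocycleD) auto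
  qed
  have "A ({v, b} \<star> {v, x}) ({v, b} \<star> {v, y}) = A ({v, b} \<star> {v, y}) ({v, b} \<star> {v, x})"
    using b xy vertices by (intro entry_sym join_in_octahedra_on) auto
  then have "block_matrix (b, x) (b, y) + block_matrix (b, y) (b, x) =
      A ({v, s} \<star> {v, x}) ({v, b} \<star> {v, y}) + A ({v, s} \<star> {v, y}) ({v, b} \<star> {v, x})"
    using block[of x y] block[of y x] xy by (simp add: algebra_simps)
  also have "\<dots> = 1"
    using b xy vertices by (intro star_entries_add_swapped) auto
  finally show ?thesis .
qed

definition corrected_matrix :: "'v \<times> 'v \<Rightarrow> 'v \<times> 'v \<Rightarrow> bit" where
  "corrected_matrix p q =
     block_matrix p q + (if fst p < fst q then block_matrix (fst p, s) (fst q, t) else 0)"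

lemma tournament_blocks_corrected_matrix: "tournament_blocks indices indices corrected_matrix"
  unfolding tournament_blocks_def tournament_matrix_on_def
proof (intro conjI ballI allI impI)
  fix p q assume "p \<in> indices" "q \<in> indices" "fst p < fst q \<and> snd p \<noteq> snd q"
  then show "corrected_matrix p q = 0"
    using block_matrix_off_diagonal[of "fst p" "fst q" "snd p" "snd q"]
    by (simp add: corrected_matrix_def mem_Times_iff less_imp_neq)
next
  fix b p q assume pq: "p \<in> {p \<in> indices \<inter> indices. fst p = b}"
    "q \<in> {p \<in> indices \<inter> indices. fst p = b}" "p \<noteq> q"
  then have "block_matrix (b, snd p) (b, snd q) + block_matrix (b, snd q) (b, snd p) = 1"
    by (intro block_matrix_diagonal) (auto simp: prod_eq_iff)
  then show "corrected_matrix p q + corrected_matrix q p = 1"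
    using pq by (auto simp: corrected_matrix_def)
qed

lemma mat_rank_block_matrix_le:
  "mat_rank indices indices block_matrix \<le> mat_rank (octahedra_on {i, j} V) (octahedra_on {i, j} V) A"
proof (rule mat_rank_reindex_le)
  show "finite (octahedra_on {i, j} V)"
    using finite_vertices by (intro finite_octahedra_on) auto
  show "(\<lambda>(b, x). {s, b} \<star> {v, x}) ` indices \<subseteq> octahedra_on {i, j} V"
    "(\<lambda>(c, y). {v, c} \<star> {v, y}) ` indices \<subseteq> octahedra_on {i, j} V"
    using vertices by (auto intro!: join_in_octahedra_on)
qed (auto simp: block_matrix_def)

lemma mat_rank_corrected_matrix_le:
  "mat_rank indices indices corrected_matrix \<le> mat_rank indices indices block_matrix + (card V - 3)"
proof -
  let ?W = "V - {v, s}"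
  let ?u = "\<lambda>b c. if b < c then block_matrix (b, s) (c, t) else 0"
  have "mat_rank indices indices (\<lambda>p q. ?u (fst p) (fst q)) \<le> mat_rank ?W ?W ?u"
    using finite_vertices by (intro mat_rank_reindex_le[where f = fst and g = fst]) auto
  also have "\<dots> \<le> card ?W - 1"
    using finite_vertices by (intro mat_rank_strict_upper_le) auto
  also have "\<dots> = card V - 3"
    using vertices by (simp add: card_Diff_subset)
  finally have "mat_rank indices indices (\<lambda>p q. ?u (fst p) (fst q)) \<le> card V - 3" .
  moreover have "mat_rank indices indices corrected_matrix \<le>
      mat_rank indices indices block_matrix + mat_rank indices indices (\<lambda>p q. ?u (fst p) (fst q))"
    using finite_vertices by (intro mat_rank_add_le) (auto simp: corrected_matrix_def)
  ultimately show ?thesis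
    by linarith
qed

lemma mat_rank_square_form_ge:
  "(card V - 3)^2 \<le> 2 * mat_rank (octahedra_on {i, j} V) (octahedra_on {i, j} V) A"
proof -
  let ?r = "mat_rank (octahedra_on {i, j} V) (octahedra_on {i, j} V) A"
  obtain m where m: "card V = 4 + m"
    using card le_Suc_ex by blast
  have cards: "card (V - {v, s}) = m + 2" "card (V - {v}) = m + 3"
    using vertices m by (simp_all add: card_Diff_subset)
  have "fst ` indices = V - {v, s}"
    using vertices by auto
  then have "(m + 2) * (m + 3) \<le> 2 * mat_rank indices indices corrected_matrix + (m + 2)"
    using card_le_mat_rank_tournament_blocks[OF _ _ tournament_blocks_corrected_matrix]
      finite_vertices by (simp add: card_cartesian_product cards)
  then have "(m + 2) * (m + 3) \<le> 2 * (?r + (m + 1)) + (m + 2)"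
    using mat_rank_corrected_matrix_le mat_rank_block_matrix_le m by simp
  then show ?thesis
    by (simp add: m power2_eq_square algebra_simps)
qed

end

lemma mat_rank_octahedral_form_ge:
  fixes V :: "'v::linorder set" and A :: "('i \<Rightarrow> 'v set) \<Rightarrow> ('i \<Rightarrow> 'v set) \<Rightarrow> bit"
  assumes "finite J" "J \<noteq> {}" "i \<notin> J" "octahedral_form (insert i J) V A"
    and card: "4 \<le> card V" and vertices: "{v, s, t} \<subseteq> V" "distinct [v, s, t]"
    and "special_sum i J {v, s} {v, t} A = 1"
  shows "(card V - 3)^2 \<le>
    2 ^ card J * mat_rank (octahedra_on (insert i J) V) (octahedra_on (insert i J) V) A"
  using assms(1-4,8)
proof (induction J arbitrary: A rule: finite_ne_induct)
  case (singleton j)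
  interpret square_form i j V A v s t
    by (rule square_form.intro) (use singleton card vertices in simp_all)
  show ?case
    using mat_rank_square_form_ge by simp
next
  case (insert j J)
  let ?r = "\<lambda>I A. mat_rank (octahedra_on I V) (octahedra_on I V) A"
  let ?C = "contract j {v, s} {v, t} A"
  have j: "j \<notin> insert i J" and i: "i \<notin> insert j J"
    using insert.hyps insert.prems by auto
  have fin: "finite V"
    using card by (intro card_ge_0_finite) simp
  have "(card V - 3)^2 \<le> 2 ^ card J * ?r (insert i J) ?C"
  proof (rule insert.IH)
    show "octahedral_form (insert i J) V ?C"
      using insert.prems(2) j card vertices
      by (intro octahedral_form_contract) (simp_all add: insert_commute)
    show "special_sum i J {v, s} {v, t} ?C = 1"
      using insert.prems(3) insert.hyps i vertices
      by (subst special_sum_contract) (auto simp: doubleton_eq_iff)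
  qed (use i in auto)
  also have "\<dots> \<le> 2 ^ card J * (2 * ?r (insert j (insert i J)) A)"
    using insert.hyps(1) fin vertices by (intro mult_left_mono mat_rank_contract_le) auto
  also have "\<dots> = 2 ^ card (insert j J) * ?r (insert i (insert j J)) A"
    using insert.hyps by (simp add: insert_commute)
  finally show ?case .
qed

section \<open>\<open>(n,k)\<close>-matrices as forms on octahedra\<close>

lemma octahedra_eq_octahedra_on: "octahedra n k = octahedra_on {1..k+1} {1..n}"
proof -
  have "{S. S \<subseteq> {1..n} \<and> card S = 2} = [{1..n}]\<^bsup>2\<^esup>"
    by (auto simp: nsets_def intro: finite_subset)
  then show ?thesis
    by (simp add: octahedra_def)
qed

definition face :: "nat \<Rightarrow> (nat \<Rightarrow> nat) \<Rightarrow> (nat \<times> nat) set" where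
  "face k f = {(j, f j) | j. j \<in> {1..k+1}}"

lemma faces_eq_image_face: "faces k P = face k ` Pi {1..k+1} P"
  by (auto simp: faces_def face_def Pi_iff)

lemma face_in_faces_iff: "face k f \<in> faces k P \<longleftrightarrow> f \<in> Pi {1..k+1} P"
proof
  assume "face k f \<in> faces k P"
  then obtain g where g: "face k f = face k g" "g \<in> Pi {1..k+1} P"
    unfolding faces_eq_image_face by blast
  have "f j = g j" if "j \<in> {1..k+1}" for j
    using eqset_imp_iff[OF g(1), of "(j, f j)"] that by (auto simp: face_def)
  then show "f \<in> Pi {1..k+1} P"
    using g(2) by (auto simp: Pi_iff)
qed (auto simp: faces_eq_image_face)

lemma faces_upd_sym_diff:
  assumes i: "i \<in> {1..k+1}" and abc: "distinct [a, b, c]"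
  shows "faces k (P(i := {a, b})) = sym_diff (faces k (P(i := {c, a}))) (faces k (P(i := {c, b})))"
proof -
  have upd: "face k f \<in> faces k (P(i := S)) \<longleftrightarrow> f i \<in> S \<and> f \<in> Pi ({1..k+1} - {i}) P" for f S
    unfolding face_in_faces_iff using i by (auto simp: Pi_iff)
  have "face k f \<in> faces k (P(i := {a, b})) \<longleftrightarrow>
      face k f \<in> sym_diff (faces k (P(i := {c, a}))) (faces k (P(i := {c, b})))" for f
    unfolding Un_iff Diff_iff upd using abc by auto
  moreover have "F \<in> range (face k)" if "F \<in> faces k Q" for F Q
    using that by (auto simp: faces_eq_image_face)
  ultimately show ?thesis
    by blast
qed

lemma octahedral_form_of_nk_matrix:
  assumes A: "nk_matrix n k A"
  shows "octahedral_form {1..k+1} {1..n} A"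
proof
  fix P Q i assume P: "P \<in> octahedra_on {1..k+1} {1..n}" and Q: "Q \<in> octahedra_on {1..k+1} {1..n}"
  then show "A P Q = A Q P"
    using A unfolding nk_matrix_def octahedra_eq_octahedra_on by blast
  show "A P Q = 0" if "\<And>i. i \<in> {1..k+1} \<Longrightarrow> P i \<inter> Q i = {}"
    using A P Q that unfolding nk_matrix_def octahedra_eq_octahedra_on vertex_disjoint_def by blast
  have additive: "A R Q = A X Q + A Y Q"
    if "R \<in> octahedra n k" "X \<in> octahedra n k" "Y \<in> octahedra n k"
      "faces k R = sym_diff (faces k X) (faces k Y)"
    for R X Y
    using A Q that unfolding nk_matrix_def octahedra_eq_octahedra_on by blast
  show "edge_cocycle {1..n} (\<lambda>S. A (P(i := S)) Q)" if "i \<in> {1..k+1}"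
    unfolding edge_cocycle_def
  proof (intro ballI impI additive)
    fix a b c assume "a \<in> {1..n}" "b \<in> {1..n}" "c \<in> {1..n}" and abc: "distinct [a, b, c]"
    then show "P(i := {a, b}) \<in> octahedra n k" "P(i := {c, a}) \<in> octahedra n k"
        "P(i := {c, b}) \<in> octahedra n k"
      using P that by (simp_all add: octahedra_eq_octahedra_on octahedra_on_upd)
    show "faces k (P(i := {a, b})) = sym_diff (faces k (P(i := {c, a}))) (faces k (P(i := {c, b})))"
      using that abc by (rule faces_upd_sym_diff)
  qed
qed

section \<open>The normalization sum\<close>

lemma flip_in_PiE: "P \<in> J \<rightarrow>\<^sub>E {S, T} \<Longrightarrow> flip S T J P \<in> J \<rightarrow>\<^sub>E {S, T}"
  by (auto simp: flip_def PiE_iff)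

lemma flip_flip: "P \<in> J \<rightarrow>\<^sub>E {S, T} \<Longrightarrow> flip S T J (flip S T J P) = P"
  by (auto simp: flip_def fun_eq_iff PiE_iff extensional_def)

lemma bij_betw_flip_pairs:
  assumes i: "i \<notin> J" and "S \<noteq> T"
  shows "bij_betw (\<lambda>P. {P(i := S), (flip S T J P)(i := T)}) (J \<rightarrow>\<^sub>E {S, T})
    ((\<lambda>P. {P, flip S T (insert i J) P}) ` (insert i J \<rightarrow>\<^sub>E {S, T}))"
proof -
  let ?h = "\<lambda>P. {P(i := S), (flip S T J P)(i := T)}"
  let ?pair = "\<lambda>P. {P, flip S T (insert i J) P}"
  have pair_S: "?pair (P(i := S)) = ?h P" for P
    using i by (simp add: flip_extend)
  have pair_T: "?pair (P(i := T)) = ?h (flip S T J P)" if "P \<in> J \<rightarrow>\<^sub>E {S, T}" for P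
    using i that by (simp add: flip_extend flip_flip insert_commute)
  have "inj_on ?h (J \<rightarrow>\<^sub>E {S, T})"
  proof (rule inj_onI)
    fix P Q assume PQ: "P \<in> J \<rightarrow>\<^sub>E {S, T}" "Q \<in> J \<rightarrow>\<^sub>E {S, T}" "?h P = ?h Q"
    have "P(i := S) \<noteq> (flip S T J Q)(i := T)"
      using assms(2) by (metis fun_upd_same)
    then have "P(i := S) = Q(i := S)"
      using PQ(3) by (auto simp: doubleton_eq_iff)
    then have "P l = Q l" if "l \<in> J" for l
      using i that by (metis fun_upd_other)
    with PQ(1,2) show "P = Q"
      by (rule PiE_ext)
  qed
  moreover have "?pair ` (insert i J \<rightarrow>\<^sub>E {S, T}) =
      (\<Union>P\<in>J \<rightarrow>\<^sub>E {S, T}. {?pair (P(i := S)), ?pair (P(i := T))})"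
    unfolding PiE_insert_eq by auto
  then have "?pair ` (insert i J \<rightarrow>\<^sub>E {S, T}) = (\<Union>P\<in>J \<rightarrow>\<^sub>E {S, T}. {?h P, ?h (flip S T J P)})"
    by (simp add: pair_S pair_T cong: SUP_cong)
  then have "?h ` (J \<rightarrow>\<^sub>E {S, T}) = ?pair ` (insert i J \<rightarrow>\<^sub>E {S, T})"
    using flip_in_PiE[of _ J S T] by auto
  ultimately show ?thesis
    unfolding bij_betw_def by blast
qed

lemma special_edge_pair_iff:
  fixes n :: nat
  assumes "n \<ge> 3"
  shows "X \<in> [{1..n}]\<^bsup>2\<^esup> \<and> Y \<in> [{1..n}]\<^bsup>2\<^esup> \<and> X \<subseteq> {1..3} \<and> Y \<subseteq> {1..3} \<and> X \<inter> Y = {1} \<longleftrightarrow>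
    X \<in> {{1, 2}, {1, 3}} \<and> Y = transpose {1, 2} {1, 3} X"
proof
  assume XY: "X \<in> [{1..n}]\<^bsup>2\<^esup> \<and> Y \<in> [{1..n}]\<^bsup>2\<^esup> \<and> X \<subseteq> {1..3} \<and> Y \<subseteq> {1..3} \<and> X \<inter> Y = {1}"
  have "\<exists>u. Z = {1, u} \<and> u \<noteq> 1" if "Z \<in> [{1..n}]\<^bsup>2\<^esup>" "1 \<in> Z" for Z
    using that by (auto simp: nsets_2_eq)
  moreover have "1 \<in> X" "1 \<in> Y"
    using XY by blast+
  ultimately obtain x y where x: "X = {1, x}" "x \<noteq> 1" and y: "Y = {1, y}" "y \<noteq> 1"
    using XY by metis
  have "x \<in> {2, 3}" "y \<in> {2, 3}" "x \<noteq> y"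
    using XY x y by auto
  then show "X \<in> {{1, 2}, {1, 3}} \<and> Y = transpose {1, 2} {1, 3} X"
    using x y by auto
next
  assume "X \<in> {{1, 2}, {1, 3}} \<and> Y = transpose {1, 2} {1, 3} X"
  then show "X \<in> [{1..n}]\<^bsup>2\<^esup> \<and> Y \<in> [{1..n}]\<^bsup>2\<^esup> \<and> X \<subseteq> {1..3} \<and> Y \<subseteq> {1..3} \<and> X \<inter> Y = {1}"
    using assms by auto
qed

lemma special_pairs_eq_image_flip:
  assumes "n \<ge> 3"
  shows "special_pairs n k =
    (\<lambda>P. {P, flip {1, 2} {1, 3} {1..k+1} P}) ` ({1..k+1} \<rightarrow>\<^sub>E {{1, 2}, {1, 3}})"
proof -
  have "P \<in> octahedra n k \<and> Q \<in> octahedra n k \<and>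
      (\<forall>i\<in>{1..k+1}. P i \<subseteq> {1..3} \<and> Q i \<subseteq> {1..3} \<and> P i \<inter> Q i = {1}) \<longleftrightarrow>
    P \<in> {1..k+1} \<rightarrow>\<^sub>E {{1, 2}, {1, 3}} \<and> Q = flip {1, 2} {1, 3} {1..k+1} P" (is "?l \<longleftrightarrow> ?r") for P Q
  proof -
    have "?l \<longleftrightarrow> P \<in> extensional {1..k+1} \<and> Q \<in> extensional {1..k+1} \<and>
        (\<forall>i\<in>{1..k+1}. P i \<in> [{1..n}]\<^bsup>2\<^esup> \<and> Q i \<in> [{1..n}]\<^bsup>2\<^esup> \<and>
          P i \<subseteq> {1..3} \<and> Q i \<subseteq> {1..3} \<and> P i \<inter> Q i = {1})"
      unfolding octahedra_eq_octahedra_on PiE_iff by blast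
    also have "\<dots> \<longleftrightarrow> P \<in> {1..k+1} \<rightarrow>\<^sub>E {{1, 2}, {1, 3}} \<and> Q \<in> extensional {1..k+1} \<and>
        (\<forall>i\<in>{1..k+1}. Q i = transpose {1, 2} {1, 3} (P i))"
      unfolding special_edge_pair_iff[OF assms] PiE_iff by blast
    also have "\<dots> \<longleftrightarrow> ?r"
      by (auto simp: flip_def fun_eq_iff extensional_def)
    finally show ?thesis .
  qed
  then show ?thesis
    unfolding special_pairs_def by (auto simp: image_iff)
qed

lemma sum_special_pairs_eq_special_sum:
  assumes "n \<ge> 3" and form: "octahedral_form {1..k+1} {1..n} A"
  shows "(\<Sum>e\<in>special_pairs n k. pair_entry A e) = special_sum 1 {2..k+1} {1, 2} {1, 3} A"
proof -
  let ?S = "{1, 2 :: nat}" and ?T = "{1, 3 :: nat}" and ?J = "{2..k+1}"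
  let ?h = "\<lambda>P. {P(1 := ?S), (flip ?S ?T ?J P)(1 := ?T)}"
  have coordinates: "{1..k+1} = insert 1 ?J"
    by auto
  have "bij_betw ?h (?J \<rightarrow>\<^sub>E {?S, ?T}) (special_pairs n k)"
    unfolding special_pairs_eq_image_flip[OF assms(1)] coordinates
    by (rule bij_betw_flip_pairs) (auto simp: doubleton_eq_iff)
  then have "(\<Sum>e\<in>special_pairs n k. pair_entry A e) = (\<Sum>P\<in>?J \<rightarrow>\<^sub>E {?S, ?T}. pair_entry A (?h P))"
    by (rule sum.reindex_bij_betw[symmetric])
  also have "\<dots> = special_sum 1 ?J ?S ?T A"
    unfolding special_sum_def
  proof (intro sum.cong refl pair_entry_eq octahedral_form.entry_sym[OF form])
    fix P assume P: "P \<in> ?J \<rightarrow>\<^sub>E {?S, ?T}"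
    have edges: "?J \<rightarrow>\<^sub>E {?S, ?T} \<subseteq> octahedra_on ?J {1..n}"
      using assms(1) by (intro PiE_mono) auto
    have "P \<in> octahedra_on ?J {1..n}" "flip ?S ?T ?J P \<in> octahedra_on ?J {1..n}"
      using subsetD[OF edges P] subsetD[OF edges flip_in_PiE[OF P]] .
    then show "P(1 := ?S) \<in> octahedra_on {1..k+1} {1..n}"
      "(flip ?S ?T ?J P)(1 := ?T) \<in> octahedra_on {1..k+1} {1..n}"
      unfolding coordinates using assms(1) by (simp_all add: octahedra_on_extend)
  qed
  finally show ?thesis .
qed

theorem theorem1p5:
  fixes n k :: nat and A :: "octahedron \<Rightarrow> octahedron \<Rightarrow> bit"
  assumes "k \<ge> 1" and "n \<ge> 4" and "nk_matrix n k A"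
  shows "real (mat_rank (octahedra n k) (octahedra n k) A) \<ge> (real n - 3)^2 / 2^k"
proof -
  let ?r = "mat_rank (octahedra n k) (octahedra n k) A"
  have coordinates: "{1..k+1} = insert 1 {2..k+1}"
    by auto
  have form: "octahedral_form {1..k+1} {1..n} A"
    using assms(3) by (rule octahedral_form_of_nk_matrix)
  moreover have "special_sum 1 {2..k+1} {1, 2} {1, 3} A = 1"
    using sum_special_pairs_eq_special_sum[OF _ form] assms(2,3) by (simp add: nk_matrix_def)
  ultimately have "(card {1..n} - 3)^2 \<le> 2 ^ card {2..k+1} * ?r"
    unfolding octahedra_eq_octahedra_on coordinates using assms(1,2)
    by (intro mat_rank_octahedral_form_ge) auto
  then have "real ((n - 3)^2) \<le> real (2^k * ?r)"
    by (intro of_nat_mono) simp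
  then have "(real n - 3)^2 \<le> 2^k * real ?r"
    using assms(2) by (simp add: of_nat_diff)
  then show ?thesis
    by (simp add: divide_le_eq mult.commute)
qed

end
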